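(* Let $\mathscr S\colon C[0,2\pi]\to C[0,2\pi]$ be the operator $(\mathscr S f)(x)=\int_0^{2\pi} f(t)(1+\cos(x-t))\,dt$, and let $C_{\mathscr S}=\operatorname{ran}\mathscr S\cap C[0,2\pi]_+$ be its range cone. Let $C=\{(a,b,c)\in\mathbb R^3:\ c\geq\sqrt{a^2+b^2}\}$, and let $u_1(t)=\cos t$, $u_2(t)=\sin t$, $u_3(t)=1$ for $t\in[0,2\pi]$. Then the mapping $$\Phi\colon(\mathbb R^3,C)\to(\operatorname{ran}\mathscr S,C_{\mathscr S}),\qquad \Phi(a,b,c)=au_1+bu_2+cu_3,$$ is an order and topological isomorphism.
   Context: $C[0,2\pi]$ is the Banach lattice of real continuous functions on $[0,2\pi]$ with the sup norm and pointwise order; $C[0,2\pi]_+$ is the cone of nonnegative functions. $(V,K)$ denotes the vector space $V$ ordered by the cone $K$. $\mathbb R^3$ carries its Euclidean topology and $\operatorname{ran}\mathscr S$ the topology induced by the sup norm. An order and topological isomorphism is a linear bijection that is a homeomorphism and maps the cone of the domain exactly onto the cone of the codomain. *)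

theory Defs
  imports "HOL-Analysis.Analysis"
begin

text \<open>
  The interval [0, 2 pi] is made a metric space of its own, so that the space of real continuous
  functions on it, with the sup norm and the pointwise vector space operations, is the library type
  of bounded continuous functions. Boundedness is automatic (\<open>continuous_imp_bcontfun\<close>).
\<close>

typedef interval2pi = "{0..2*pi}"
  morphisms real_of_interval interval_of_real
  by (rule exI[of _ 0]) auto

instantiation interval2pi :: metric_space
begin

definition dist_interval2pi :: "interval2pi \<Rightarrow> interval2pi \<Rightarrow> real"
  where "dist_interval2pi x y = dist (real_of_interval x) (real_of_interval y)"

definition uniformity_interval2pi :: "(interval2pi \<times> interval2pi) filter"
  where "uniformity_interval2pi = (INF e\<in>{0 <..}. principal {(x, y). dist x y < e})"

definition open_interval2pi :: "interval2pi set \<Rightarrow> bool"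
  where "open_interval2pi S = (\<forall>x\<in>S. \<forall>\<^sub>F (x', y) in uniformity. x' = x \<longrightarrow> y \<in> S)"

instance
proof
  fix x y z :: interval2pi
  show "dist x y = 0 \<longleftrightarrow> x = y"
    by (simp add: dist_interval2pi_def real_of_interval_inject)
  show "dist x y \<le> dist x z + dist y z"
    by (simp add: dist_interval2pi_def dist_triangle2)
qed (simp_all add: uniformity_interval2pi_def open_interval2pi_def)

end

lemma continuous_on_real_of_interval [continuous_intros]:
  assumes "continuous_on A f"
  shows "continuous_on A (\<lambda>x. real_of_interval (f x))"
proof -
  have "continuous_on UNIV real_of_interval"
    unfolding continuous_on_iff by (auto simp: dist_interval2pi_def)
  then show ?thesis
    using assms continuous_on_compose2 by blast
qed

lemma continuous_on_interval_of_real: "continuous_on {0..2*pi} interval_of_real"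
  unfolding continuous_on_iff by (auto simp: dist_interval2pi_def interval_of_real_inverse)

lemma homeomorphism_interval2pi:
  "homeomorphism UNIV {0..2*pi} real_of_interval interval_of_real"
  unfolding homeomorphism_def
proof (intro conjI ballI)
  show "real_of_interval ` UNIV = {0..2*pi}"
    using type_definition.Rep_range[OF type_definition_interval2pi] .
  show "interval_of_real ` {0..2*pi} = UNIV"
    using type_definition.Abs_image[OF type_definition_interval2pi] .
qed (auto simp: real_of_interval_inverse interval_of_real_inverse
      intro: continuous_on_interval_of_real continuous_intros)

lemma compact_UNIV_interval2pi: "compact (UNIV :: interval2pi set)"
  using compact_continuous_image[OF continuous_on_interval_of_real compact_Icc]
    homeomorphism_image2[OF homeomorphism_interval2pi] by simp

lemma continuous_imp_bcontfun:
  fixes f :: "interval2pi \<Rightarrow> real"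
  assumes "continuous_on UNIV f"
  shows "f \<in> bcontfun"
  using assms compact_continuous_image[OF assms compact_UNIV_interval2pi]
  by (simp add: bcontfun_def compact_imp_bounded)

type_synonym C2pi = "interval2pi \<Rightarrow>\<^sub>C real"

unbundle bcontfun.lifting

definition C2pi_nonneg :: "C2pi set"
  where "C2pi_nonneg = {f. \<forall>t. 0 \<le> apply_bcontfun f t}"

lift_definition S_op :: "C2pi \<Rightarrow> C2pi"
  is "\<lambda>f x. integral {0..2*pi}
        (\<lambda>t. f (interval_of_real t) * (1 + cos (real_of_interval x - t)))"
proof (rule continuous_imp_bcontfun)
  fix f :: "interval2pi \<Rightarrow> real"
  assume "f \<in> bcontfun"
  then have "continuous_on UNIV f" by (simp add: bcontfun_def)
  then have f: "continuous_on (UNIV \<times> {0..2*pi})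
      (\<lambda>p::interval2pi \<times> real. f (interval_of_real (snd p)))"
    by (rule continuous_on_compose2)
       (auto intro!: continuous_on_compose2[OF continuous_on_interval_of_real] continuous_intros)
  have "continuous_on (UNIV \<times> cbox 0 (2*pi))
      (\<lambda>(x, t). f (interval_of_real t) * (1 + cos (real_of_interval x - t)))"
    unfolding case_prod_unfold cbox_interval
    by (intro continuous_intros f)
  from integral_continuous_on_param[OF this]
  show "continuous_on UNIV (\<lambda>x. integral {0..2*pi}
        (\<lambda>t. f (interval_of_real t) * (1 + cos (real_of_interval x - t))))"
    by (simp add: cbox_interval)
qed

definition range_cone :: "C2pi set"
  where "range_cone = range S_op \<inter> C2pi_nonneg"

definition circular_cone :: "(real^3) set"
  where "circular_cone = {v. v $ 3 \<ge> sqrt ((v $ 1)\<^sup>2 + (v $ 2)\<^sup>2)}"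

lift_definition u1 :: C2pi is "\<lambda>t. cos (real_of_interval t)"
  by (intro continuous_imp_bcontfun continuous_intros)

lift_definition u2 :: C2pi is "\<lambda>t. sin (real_of_interval t)"
  by (intro continuous_imp_bcontfun continuous_intros)

lift_definition u3 :: C2pi is "\<lambda>t. 1"
  by (intro continuous_imp_bcontfun continuous_intros)

definition Phi :: "real^3 \<Rightarrow> C2pi"
  where "Phi v = v $ 1 *\<^sub>R u1 + v $ 2 *\<^sub>R u2 + v $ 3 *\<^sub>R u3"

text \<open>
  The domain is a whole type ordered by the cone \<open>K\<close>; the codomain is a set \<open>W\<close> of vectors
  with the subspace topology, ordered by \<open>L\<close>. That \<open>W\<close> is a linear subspace follows, as \<open>W\<close> is
  the image of a linear map.
\<close>

definition order_topological_isomorphism ::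
    "('a::real_normed_vector \<Rightarrow> 'b::real_normed_vector) \<Rightarrow> 'a set \<Rightarrow> 'b set \<Rightarrow> 'b set \<Rightarrow> bool"
  where "order_topological_isomorphism F K W L \<longleftrightarrow>
    linear F \<and> bij_betw F UNIV W \<and>
    homeomorphic_map euclidean (top_of_set W) F \<and>
    F ` K = L"

end

theory Submission
  imports Defs
begin

text \<open>
  The addition theorem gives the kernel the form \<open>1 + cos x cos t + sin x sin t\<close>, so \<open>S f\<close> is the
  trigonometric polynomial with coefficients \<open>\<integral>f cos\<close>, \<open>\<integral>f sin\<close>, \<open>\<integral>f\<close>; conversely \<open>u1\<close>, \<open>u2\<close>,
  \<open>u3\<close> are eigenvectors of \<open>S\<close> with eigenvalues \<open>\<pi>\<close>, \<open>\<pi>\<close>, \<open>2\<pi>\<close>. Since the minimum of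
  \<open>a cos t + b sin t\<close> is \<open>-sqrt (a\<^sup>2 + b\<^sup>2)\<close>, nonnegativity of such a polynomial is membership in the
  circular cone. Evaluation at \<open>0\<close>, \<open>\<pi>/2\<close>, \<open>\<pi>\<close> recovers the coefficients continuously.
\<close>

lemma apply_Phi:
  "apply_bcontfun (Phi v) x =
    v $ 1 * cos (real_of_interval x) + v $ 2 * sin (real_of_interval x) + v $ 3"
  by (simp add: Phi_def plus_bcontfun.rep_eq scaleR_bcontfun.rep_eq u1.rep_eq u2.rep_eq u3.rep_eq)

lemma apply_Phi_interval_of_real:
  assumes "t \<in> {0..2*pi}"
  shows "apply_bcontfun (Phi v) (interval_of_real t) = v $ 1 * cos t + v $ 2 * sin t + v $ 3"
  using assms by (simp add: apply_Phi interval_of_real_inverse)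

lemma linear_Phi: "linear Phi"
  by (rule linearI) (simp_all add: Phi_def algebra_simps)

text \<open>Yields the inclusion of \<open>range S_op\<close> in \<open>range Phi\<close>.
  Continuity of \<open>f\<close> makes the three integrals exist, so the integral may be
  split.\<close>

lemma S_op_eq_Phi:
  "S_op f = Phi (vector
    [integral {0..2*pi} (\<lambda>t. apply_bcontfun f (interval_of_real t) * cos t),
     integral {0..2*pi} (\<lambda>t. apply_bcontfun f (interval_of_real t) * sin t),
     integral {0..2*pi} (\<lambda>t. apply_bcontfun f (interval_of_real t))])"
proof (rule bcontfun_eqI)
  fix x
  let ?g = "\<lambda>t. apply_bcontfun f (interval_of_real t)" and ?x = "real_of_interval x"
  have g: "continuous_on {0..2*pi} ?g"
    by (rule continuous_on_compose2[OF _ continuous_on_interval_of_real])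
      (auto intro: continuous_on_apply_bcontfun)
  note int = integrable_continuous_real
  have "integral {0..2*pi} (\<lambda>t. ?g t * (1 + cos (?x - t))) =
      integral {0..2*pi} (\<lambda>t. cos ?x * (?g t * cos t) + sin ?x * (?g t * sin t) + ?g t)"
    by (simp add: cos_diff algebra_simps)
  also have "\<dots> = cos ?x * integral {0..2*pi} (\<lambda>t. ?g t * cos t)
      + sin ?x * integral {0..2*pi} (\<lambda>t. ?g t * sin t) + integral {0..2*pi} ?g"
    by (simp add: integral_add int g continuous_intros)
  finally show "apply_bcontfun (S_op f) x = apply_bcontfun (Phi (vector
    [integral {0..2*pi} (\<lambda>t. ?g t * cos t), integral {0..2*pi} (\<lambda>t. ?g t * sin t),
     integral {0..2*pi} ?g])) x"
    by (simp add: S_op.rep_eq apply_Phi vector_3 mult.commute)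
qed

lemma S_op_Phi: "S_op (Phi v) = Phi (vector [pi * v $ 1, pi * v $ 2, 2 * pi * v $ 3])"
proof (rule bcontfun_eqI)
  fix x
  define y where "y = real_of_interval x"
  \<comment> \<open>Antiderivative of the integrand, found by expanding \<open>cos (y - t)\<close>
    and integrating term by term. Over a full period only the terms linear in \<open>t\<close>
    contribute, which produces the factors \<open>pi\<close>, \<open>pi\<close> and
    \<open>2 * pi\<close>.\<close>
  define F where "F t = v $ 1 * sin t - v $ 2 * cos t + v $ 3 * t
      + cos y * (v $ 1 * (t + sin t * cos t) / 2 + v $ 2 * (sin t)\<^sup>2 / 2 + v $ 3 * sin t)
      + sin y * (v $ 1 * (sin t)\<^sup>2 / 2 + v $ 2 * (t - sin t * cos t) / 2 - v $ 3 * cos t)" for t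
  have "(F has_real_derivative
      (v $ 1 * cos t + v $ 2 * sin t + v $ 3) * (1 + cos (y - t))) (at t within {0..2*pi})" for t
  proof -
    have "sin t * sin t = 1 - cos t * cos t"
      using sin_cos_squared_add[of t] by (simp add: power2_eq_square)
    \<comment> \<open>The free factor \<open>z\<close> lets the rewriting reach a squared sine
      inside a longer, right-nested product.\<close>
    then have sin2: "sin t * (sin t * z) = z - cos t * (cos t * z)" for z
      by algebra
    show ?thesis
      unfolding F_def
      by (auto intro!: derivative_eq_intros simp: cos_diff power2_eq_square field_simps sin2)
  qed
  then have "((\<lambda>t. (v $ 1 * cos t + v $ 2 * sin t + v $ 3) * (1 + cos (y - t)))
      has_integral F (2*pi) - F 0) {0..2*pi}"
    by (intro fundamental_theorem_of_calculus)
      (auto simp: has_real_derivative_iff_has_vector_derivative)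
  moreover have "F (2*pi) - F 0 = pi * v $ 1 * cos y + pi * v $ 2 * sin y + 2 * pi * v $ 3"
    by (simp add: F_def field_simps)
  ultimately have "integral {0..2*pi}
      (\<lambda>t. (v $ 1 * cos t + v $ 2 * sin t + v $ 3) * (1 + cos (y - t)))
      = pi * v $ 1 * cos y + pi * v $ 2 * sin y + 2 * pi * v $ 3"
    by (simp add: integral_unique)
  moreover have "integral {0..2*pi}
      (\<lambda>t. apply_bcontfun (Phi v) (interval_of_real t) * (1 + cos (y - t)))
      = integral {0..2*pi} (\<lambda>t. (v $ 1 * cos t + v $ 2 * sin t + v $ 3) * (1 + cos (y - t)))"
    by (rule integral_cong) (simp add: apply_Phi_interval_of_real)
  ultimately show "apply_bcontfun (S_op (Phi v)) x =
      apply_bcontfun (Phi (vector [pi * v $ 1, pi * v $ 2, 2 * pi * v $ 3])) x"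
    by (simp add: S_op.rep_eq apply_Phi vector_3 y_def)
qed

lemma range_S_op: "range S_op = range Phi"
proof
  show "range S_op \<subseteq> range Phi"
    using S_op_eq_Phi by blast
  show "range Phi \<subseteq> range S_op"
  proof clarify
    fix v
    \<comment> \<open>A preimage of \<open>Phi v\<close> under \<open>S_op\<close> arises by
      dividing each coefficient by its nonzero eigenvalue.\<close>
    have "(vector [pi * (v $ 1 / pi), pi * (v $ 2 / pi), 2 * pi * (v $ 3 / (2 * pi))] :: real^3) = v"
      by (simp add: vec_eq_iff forall_3 vector_3)
    then have "S_op (Phi (vector [v $ 1 / pi, v $ 2 / pi, v $ 3 / (2 * pi)])) = Phi v"
      by (simp add: S_op_Phi vector_3)
    then show "Phi v \<in> range S_op"
      by (metis rangeI)
  qed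
qed

text \<open>On \<open>Phi v\<close> with coefficients a, b, c the three values are a + c, b + c and
  c - a; this solves for a, b, c. Being defined on all of \<open>C2pi\<close>, it is a continuous
  left inverse of \<open>Phi\<close>.\<close>

definition coeffs_C2pi :: "C2pi \<Rightarrow> real^3" where
  "coeffs_C2pi f =
    (let p = apply_bcontfun f (interval_of_real 0); q = apply_bcontfun f (interval_of_real (pi/2));
         r = apply_bcontfun f (interval_of_real pi)
     in vector [(p - r) / 2, q - (p + r) / 2, (p + r) / 2])"

lemma coeffs_C2pi_Phi: "coeffs_C2pi (Phi v) = v"
  by (simp add: coeffs_C2pi_def Let_def apply_Phi_interval_of_real vec_eq_iff forall_3 vector_3)

lemma continuous_on_coeffs_C2pi: "continuous_on A coeffs_C2pi"
proof -
  \<comment> \<open>Point evaluation is a linear functional bounded by the sup norm.\<close>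
  have ev: "continuous_on A (\<lambda>f. apply_bcontfun f x)" for x :: interval2pi
    by (intro linear_continuous_on bounded_linear_intro[where K = 1])
      (simp_all add: plus_bcontfun.rep_eq scaleR_bcontfun.rep_eq norm_bounded del: real_norm_def)
  have "continuous_on A (\<lambda>f. coeffs_C2pi f $ i)" for i
    using exhaust_3[of i]
    by (elim disjE; simp add: coeffs_C2pi_def Let_def vector_3)
      (auto intro!: continuous_intros ev)
  then show ?thesis
    by (subst continuous_on_componentwise)
      (auto simp: Basis_vec_def inner_axis)
qed

lemma Phi_nonneg_iff: "Phi v \<in> C2pi_nonneg \<longleftrightarrow> v \<in> circular_cone"
proof -
  define r where "r = sqrt ((v $ 1)\<^sup>2 + (v $ 2)\<^sup>2)"
  have r2: "r\<^sup>2 = (v $ 1)\<^sup>2 + (v $ 2)\<^sup>2" and "0 \<le> r"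
    by (simp_all add: r_def)
  show ?thesis
  proof
    assume nonneg: "Phi v \<in> C2pi_nonneg"
    \<comment> \<open>The angle where the minimum is attained: \<open>(cos t, sin t)\<close> points
      opposite to \<open>(v $ 1, v $ 2)\<close>. If \<open>r = 0\<close>, both coefficients vanish
      and \<open>t = 0\<close> serves.\<close>
    obtain t where t: "t \<in> {0..2*pi}" "v $ 1 = - r * cos t" "v $ 2 = - r * sin t"
    proof (cases "r = 0")
      case True
      then show ?thesis
        using r2 that[of 0] by (simp add: sum_power2_eq_zero_iff)
    next
      case False
      then have "(- v $ 1 / r)\<^sup>2 + (- v $ 2 / r)\<^sup>2 = 1"
        by (simp add: power_divide flip: add_divide_distrib r2)
      then obtain t where "0 \<le> t" "t \<le> 2*pi" "- v $ 1 / r = cos t" "- v $ 2 / r = sin t"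
        by (rule sincos_total_2pi_le[elim_format]) auto
      with False show ?thesis
        by (intro that[of t]) (auto simp: field_simps)
    qed
    have "0 \<le> v $ 1 * cos t + v $ 2 * sin t + v $ 3"
      using nonneg by (simp add: C2pi_nonneg_def flip: apply_Phi_interval_of_real[OF t(1)])
    also have "\<dots> = v $ 3 - r * ((cos t)\<^sup>2 + (sin t)\<^sup>2)"
      unfolding t(2,3) by algebra
    finally show "v \<in> circular_cone"
      by (simp add: circular_cone_def r_def)
  next
    assume "v \<in> circular_cone"
    then have "r \<le> v $ 3"
      by (simp add: circular_cone_def r_def)
    moreover have "- r \<le> v $ 1 * cos s + v $ 2 * sin s" for s
    proof -
      \<comment> \<open>Lagrange's identity; dropping the second square leaves the Cauchy-Schwarz
        bound.\<close>
      have "(v $ 1 * cos s + v $ 2 * sin s)\<^sup>2 + (v $ 1 * sin s - v $ 2 * cos s)\<^sup>2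
          = ((v $ 1)\<^sup>2 + (v $ 2)\<^sup>2) * ((cos s)\<^sup>2 + (sin s)\<^sup>2)"
        by algebra
      then have "(v $ 1 * cos s + v $ 2 * sin s)\<^sup>2 \<le> r\<^sup>2"
        by (simp add: r2) (metis le_add_same_cancel1 zero_le_power2)
      then show ?thesis
        using \<open>0 \<le> r\<close> abs_le_square_iff[of "v $ 1 * cos s + v $ 2 * sin s" r] by linarith
    qed
    ultimately show "Phi v \<in> C2pi_nonneg"
      by (simp add: C2pi_nonneg_def apply_Phi) (smt (verit))
  qed
qed

theorem proposition5p2:
  shows "order_topological_isomorphism Phi circular_cone (range S_op) range_cone"
proof -
  have inj: "inj Phi"
    by (rule inj_on_inverseI[of _ coeffs_C2pi]) (rule coeffs_C2pi_Phi)
  have "continuous_on UNIV Phi"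
    using linear_Phi by (simp add: linear_continuous_on linear_conv_bounded_linear)
  then have "homeomorphic_maps euclidean (top_of_set (range Phi)) Phi coeffs_C2pi"
    using continuous_on_coeffs_C2pi
    by (auto simp: homeomorphic_maps_def coeffs_C2pi_Phi continuous_map_in_subtopology)
  then have "homeomorphic_map euclidean (top_of_set (range Phi)) Phi"
    using homeomorphic_map_maps by blast
  \<comment> \<open>Once \<open>range S_op\<close> is \<open>range Phi\<close>, lying in the range
    cone is just nonnegativity of some \<open>Phi v\<close>.\<close>
  moreover have "Phi ` circular_cone = range_cone"
    unfolding range_cone_def range_S_op by (auto simp: Phi_nonneg_iff)
  ultimately show ?thesis
    unfolding order_topological_isomorphism_def range_S_op
    using linear_Phi inj by (simp add: bij_betw_def)
qed

end
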